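(* Let $\mathcal{H}$ be an infinite-dimensional separable complex Hilbert space with orthonormal basis $\{e_n\}_{n=0}^\infty$. Let $D \in \mathcal{B}(\mathcal{H})$ be the diagonal operator $D e_n = \alpha_n e_n$ with $\alpha_n \neq 0$ for all $n \ge 0$, and let $f = \sum_{n=0}^\infty a_n e_n$ and $g = \sum_{n=0}^\infty b_n e_n$ be vectors in $\mathcal{H}$ with $a_n \neq 0$ and $b_n \neq 0$ for all $n \geq 0$. Then $D + f\otimes g$ is left-invertible if and only if $D+f\otimes g$ is invertible.
   Context: $\mathcal{B}(\mathcal{H})$ is the algebra of bounded linear operators on $\mathcal{H}$. Inner products are linear in the first variable. For $f,g\in\mathcal{H}$, $(f \otimes g)h = \langle h, g\rangle f$ for $h \in \mathcal{H}$. An operator $T \in \mathcal{B}(\mathcal{H})$ is left-invertible if there exists $S \in \mathcal{B}(\mathcal{H})$ with $ST = I_{\mathcal{H}}$ (equivalently, $T$ is bounded below); it is invertible if it has a two-sided inverse in $\mathcal{B}(\mathcal{H})$. *)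

theory Defs
  imports "HOL-Analysis.Analysis"
begin

class scaleC =
  fixes scaleC :: "complex \<Rightarrow> 'a \<Rightarrow> 'a"  (infixr "*\<^sub>C" 75)

class complex_vector = real_vector + scaleC +
  assumes scaleC_add_right: "c *\<^sub>C (x + y) = c *\<^sub>C x + c *\<^sub>C y"
    and scaleC_add_left: "(c + d) *\<^sub>C x = c *\<^sub>C x + d *\<^sub>C x"
    and scaleC_scaleC: "c *\<^sub>C (d *\<^sub>C x) = (c * d) *\<^sub>C x"
    and scaleC_one: "1 *\<^sub>C x = x"
    and scaleR_scaleC: "r *\<^sub>R x = complex_of_real r *\<^sub>C x"

text \<open>The inner product is linear in its first argument.\<close>

class complex_inner = complex_vector + real_normed_vector +
  fixes cinner :: "'a \<Rightarrow> 'a \<Rightarrow> complex"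
  assumes cinner_commute: "cinner x y = cnj (cinner y x)"
    and cinner_add_left: "cinner (x + y) z = cinner x z + cinner y z"
    and cinner_scaleC_left: "cinner (c *\<^sub>C x) y = c * cinner x y"
    and cinner_ge_zero: "0 \<le> Re (cinner x x)"
    and cinner_eq_zero_iff: "cinner x x = 0 \<longleftrightarrow> x = 0"
    and norm_eq_sqrt_cinner: "norm x = sqrt (Re (cinner x x))"

class chilbert_space = complex_inner + complete_space

global_interpretation complex_vector:
  vector_space "scaleC :: complex \<Rightarrow> 'a \<Rightarrow> 'a::complex_vector"
  by unfold_locales
    (simp_all add: scaleC_add_right scaleC_add_left scaleC_scaleC scaleC_one)

definition bounded_clinear :: "('a::complex_inner \<Rightarrow> 'b::complex_inner) \<Rightarrow> bool" where
  "bounded_clinear T \<longleftrightarrow> bounded_linear T \<and> (\<forall>c x. T (c *\<^sub>C x) = c *\<^sub>C T x)"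

definition orthonormal_basis :: "(nat \<Rightarrow> 'a::complex_inner) \<Rightarrow> bool" where
  "orthonormal_basis e \<longleftrightarrow>
     (\<forall>m n. cinner (e m) (e n) = (if m = n then 1 else 0)) \<and>
     closure (complex_vector.span (range e)) = UNIV"

definition rank_one :: "'a::complex_inner \<Rightarrow> 'a \<Rightarrow> 'a \<Rightarrow> 'a" where
  "rank_one f g h = cinner h g *\<^sub>C f"

definition left_invertible_op :: "('a::complex_inner \<Rightarrow> 'a) \<Rightarrow> bool" where
  "left_invertible_op T \<longleftrightarrow> (\<exists>S. bounded_clinear S \<and> S \<circ> T = id)"

definition invertible_op :: "('a::complex_inner \<Rightarrow> 'a) \<Rightarrow> bool" where
  "invertible_op T \<longleftrightarrow> (\<exists>S. bounded_clinear S \<and> S \<circ> T = id \<and> T \<circ> S = id)"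

end

theory Submission
  imports Defs
begin

text \<open>If \<open>T = D + f \<otimes> g\<close> is bounded below, then, since \<open>\<langle>e n, g\<rangle> \<longlonglongrightarrow> 0\<close>, the
  vectors \<open>T (e n) = \<alpha> n e n + \<langle>e n, g\<rangle> f\<close> can only stay away from \<open>0\<close> if \<open>\<alpha>\<close> does. So \<open>D\<close> is
  bounded below, and its range, being closed and containing every \<open>e n\<close>, is the whole space.
  Writing \<open>f = D u\<close> gives \<open>T = D (I + u \<otimes> g)\<close>; injectivity of \<open>T\<close> forces \<open>1 + \<langle>u, g\<rangle> \<noteq> 0\<close>, which
  makes \<open>I + u \<otimes> g\<close>, and hence \<open>T\<close>, surjective.\<close>

section \<open>Inner product calculus and the norm\<close>

lemma cinner_zero_left [simp]: "cinner 0 (y::'a::complex_inner) = 0"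
  using cinner_add_left[of 0 0 y] by simp

lemma cinner_add_right: "cinner (x::'a::complex_inner) (y + z) = cinner x y + cinner x z"
  by (metis cinner_add_left cinner_commute complex_cnj_add)

lemma cinner_scaleC_right: "cinner (x::'a::complex_inner) (c *\<^sub>C y) = cnj c * cinner x y"
  by (metis cinner_commute cinner_scaleC_left complex_cnj_mult)

lemma cinner_diff_left: "cinner (x - y) (z::'a::complex_inner) = cinner x z - cinner y z"
  using cinner_add_left[of "x - y" y z] by simp

lemma cinner_diff_right: "cinner (x::'a::complex_inner) (y - z) = cinner x y - cinner x z"
  using cinner_add_right[of x "y - z" z] by simp

lemma cinner_sum_left: "cinner (\<Sum>k\<in>A. F k) (y::'a::complex_inner) = (\<Sum>k\<in>A. cinner (F k) y)"
  by (induction A rule: infinite_finite_induct) (simp_all add: cinner_add_left)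

lemma cinner_sum_right: "cinner (x::'a::complex_inner) (\<Sum>k\<in>A. F k) = (\<Sum>k\<in>A. cinner x (F k))"
proof -
  have "cinner x (\<Sum>k\<in>A. F k) = (\<Sum>k\<in>A. cnj (cinner (F k) x))"
    by (subst cinner_commute) (simp add: cinner_sum_left)
  also have "\<dots> = (\<Sum>k\<in>A. cinner x (F k))"
    by (rule sum.cong[OF refl]) (rule cinner_commute[symmetric])
  finally show ?thesis .
qed

text \<open>Conjugate symmetry makes the value real. Read from right to left, the equation turns
  squared norms into inner products, which can then be expanded by sesquilinearity.\<close>

lemma cinner_self: "cinner x x = complex_of_real ((norm (x::'a::complex_inner))\<^sup>2)"
proof (rule complex_eqI)
  show "Re (cinner x x) = Re (complex_of_real ((norm x)\<^sup>2))"
    by (simp add: norm_eq_sqrt_cinner cinner_ge_zero)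
  show "Im (cinner x x) = Im (complex_of_real ((norm x)\<^sup>2))"
    using cinner_commute[of x x] by (simp add: complex_eq_iff)
qed

lemma norm_scaleC: "norm (c *\<^sub>C (x::'a::complex_inner)) = cmod c * norm x"
proof (rule power2_eq_imp_eq)
  have "complex_of_real ((norm (c *\<^sub>C x))\<^sup>2) = complex_of_real ((cmod c * norm x)\<^sup>2)"
    unfolding cinner_self[symmetric] cinner_scaleC_left cinner_scaleC_right
    by (simp add: cinner_self power_mult_distrib complex_norm_square del: of_real_power)
  then show "(norm (c *\<^sub>C x))\<^sup>2 = (cmod c * norm x)\<^sup>2"
    by (simp only: of_real_eq_iff)
qed auto

text \<open>The Cauchy-Schwarz inequality for a unit vector: subtracting from \<open>y\<close> its
  projection onto \<open>x\<close> leaves a residual whose squared norm is nonnegative.\<close>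

lemma cmod_cinner_unit_le:
  fixes x y :: "'a::complex_inner"
  assumes "norm x = 1"
  shows "cmod (cinner x y) \<le> norm y"
proof -
  define z where "z = y - cinner y x *\<^sub>C x"
  have "complex_of_real ((norm z)\<^sup>2) = cinner y y - cnj (cinner y x) * cinner y x"
    unfolding cinner_self[symmetric] z_def
    using assms cinner_commute[of x y]
    by (simp add: cinner_diff_left cinner_diff_right cinner_scaleC_left cinner_scaleC_right
        cinner_self[of x])
  also have "\<dots> = complex_of_real ((norm y)\<^sup>2 - (cmod (cinner y x))\<^sup>2)"
    by (simp add: cinner_self complex_norm_square mult.commute flip: of_real_power)
  finally have "(norm z)\<^sup>2 = (norm y)\<^sup>2 - (cmod (cinner y x))\<^sup>2"
    by (simp only: of_real_eq_iff)
  then have "(cmod (cinner y x))\<^sup>2 \<le> (norm y)\<^sup>2"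
    using zero_le_power2[of "norm z"] by linarith
  then have "cmod (cinner y x) \<le> norm y"
    by (rule power2_le_imp_le) simp
  then show ?thesis
    by (subst cinner_commute) simp
qed

section \<open>Orthonormal bases and finite combinations\<close>

lemma bounded_clinear_scaleC: "bounded_clinear T \<Longrightarrow> T (c *\<^sub>C x) = c *\<^sub>C T x"
  by (simp add: bounded_clinear_def)

lemma bounded_clinear_bounded_linear: "bounded_clinear T \<Longrightarrow> bounded_linear T"
  by (simp add: bounded_clinear_def)

lemma orthonormal_basis_cinner:
  "orthonormal_basis e \<Longrightarrow> cinner (e m) (e n) = (if m = n then 1 else 0)"
  by (simp add: orthonormal_basis_def)

lemma orthonormal_basis_norm: "orthonormal_basis e \<Longrightarrow> norm (e n) = 1"
  by (simp add: norm_eq_sqrt_cinner orthonormal_basis_cinner)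

text \<open>Pythagoras: orthonormality leaves only the diagonal of the double sum.\<close>

lemma norm_sum_orthonormal:
  assumes "orthonormal_basis e" "finite A"
  shows "(norm (\<Sum>k\<in>A. c k *\<^sub>C e k))\<^sup>2 = (\<Sum>k\<in>A. (cmod (c k))\<^sup>2)"
proof -
  have "complex_of_real ((norm (\<Sum>k\<in>A. c k *\<^sub>C e k))\<^sup>2)
      = (\<Sum>k\<in>A. \<Sum>j\<in>A. cnj (c k) * (c j * (if j = k then 1 else 0)))"
    unfolding cinner_self[symmetric] cinner_sum_left cinner_sum_right
      cinner_scaleC_left cinner_scaleC_right orthonormal_basis_cinner[OF assms(1)]
    by (simp add: sum_distrib_left)
  also have "\<dots> = complex_of_real (\<Sum>k\<in>A. (cmod (c k))\<^sup>2)"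
    using assms(2) by (simp add: complex_norm_square mult.commute if_distrib cong: if_cong del: of_real_power)
  finally show ?thesis
    by (simp only: of_real_eq_iff)
qed

lemma span_range_finite_sum:
  fixes e :: "nat \<Rightarrow> 'a::complex_inner"
  assumes "x \<in> complex_vector.span (range e)"
  obtains A c where "finite A" "x = (\<Sum>k\<in>A. c k *\<^sub>C e k)"
proof -
  have "\<exists>A c. finite A \<and> x = (\<Sum>k\<in>A. c k *\<^sub>C e k)"
    using assms
  proof (induction rule: complex_vector.span_induct_alt)
    case base
    show ?case by (intro exI[of _ "{}"]) simp
  next
    case (step r v x)
    then obtain n A c where v: "v = e n" and A: "finite A" and x: "x = (\<Sum>k\<in>A. c k *\<^sub>C e k)"
      by blast
    \<comment> \<open>Extending \<open>c\<close> by zero puts both summands over the same index set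
      \<open>insert n A\<close>, whether or not \<open>n\<close> already lies in
      \<open>A\<close>.\<close>
    define d where "d k = (if k \<in> A then c k else 0)" for k
    have "x = (\<Sum>k\<in>insert n A. d k *\<^sub>C e k)"
      unfolding x d_def using A by (intro sum.mono_neutral_cong_left) auto
    moreover have "r *\<^sub>C v = (\<Sum>k\<in>insert n A. (if k = n then r else 0) *\<^sub>C e k)"
      using A by (simp add: v if_distrib[of "\<lambda>c. c *\<^sub>C _"] cong: if_cong)
    ultimately have "r *\<^sub>C v + x
        = (\<Sum>k\<in>insert n A. ((if k = n then r else 0) + d k) *\<^sub>C e k)"
      by (simp only: scaleC_add_left sum.distrib)
    moreover have "finite (insert n A)" using A by simp
    ultimately show ?case by (intro exI conjI) assumption+
  qed
  with that show thesis by blast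
qed

text \<open>\<open>e n\<close> is orthogonal to every term of the series for \<open>g\<close> of
  index below \<open>n\<close>, so it sees only the tail \<open>R n\<close>, whose norm tends to
  0.\<close>

lemma cinner_orthonormal_tendsto_0:
  assumes e: "orthonormal_basis e" and g: "(\<lambda>n. b n *\<^sub>C e n) sums g"
  shows "(\<lambda>n. cinner (e n) g) \<longlonglongrightarrow> 0"
proof (rule Lim_null_comparison)
  define R where "R n = g - (\<Sum>k<n. b k *\<^sub>C e k)" for n
  have "cinner (e n) (\<Sum>k<n. b k *\<^sub>C e k) = 0" for n
    by (simp add: cinner_sum_right cinner_scaleC_right orthonormal_basis_cinner[OF e])
  then have "cinner (e n) g = cinner (e n) (R n)" for n
    by (simp add: R_def cinner_diff_right)
  then show "\<forall>\<^sub>F n in sequentially. norm (cinner (e n) g) \<le> norm (R n)"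
    using cmod_cinner_unit_le[OF orthonormal_basis_norm[OF e]] by (simp add: always_eventually)
  show "(\<lambda>n. norm (R n)) \<longlonglongrightarrow> 0"
    unfolding R_def using g by (intro tendsto_eq_intros | simp add: sums_def)+
qed

section \<open>Diagonal operators with coefficients bounded away from zero\<close>

lemma diagonal_bounded_below:
  fixes e :: "nat \<Rightarrow> 'a::complex_inner"
  assumes e: "orthonormal_basis e" and D: "bounded_clinear D"
    and De: "\<And>n. D (e n) = \<alpha> n *\<^sub>C e n"
    and \<delta>: "0 \<le> \<delta>" "\<And>n. \<delta> \<le> cmod (\<alpha> n)"
  shows "\<delta> * norm x \<le> norm (D x)"
proof -
  interpret D: bounded_linear D using D by (rule bounded_clinear_bounded_linear)
  let ?B = "{x. \<delta> * norm x \<le> norm (D x)}"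
  \<comment> \<open>On finite combinations Pythagoras reduces the bound to a comparison of
    coefficients; density of the span and closedness of \<open>?B\<close> then give it
    everywhere.\<close>
  have "\<delta> * norm x \<le> norm (D x)" if x: "x \<in> complex_vector.span (range e)" for x
  proof -
    obtain A c where A: "finite A" and xc: "x = (\<Sum>k\<in>A. c k *\<^sub>C e k)"
      using span_range_finite_sum[OF x] by blast
    have "D x = (\<Sum>k\<in>A. (c k * \<alpha> k) *\<^sub>C e k)"
      by (simp add: xc D.sum bounded_clinear_scaleC[OF D] De scaleC_scaleC)
    then have "(norm (D x))\<^sup>2 = (\<Sum>k\<in>A. (cmod (c k * \<alpha> k))\<^sup>2)"
      using norm_sum_orthonormal[OF e A] by simp
    also have "\<dots> \<ge> (\<Sum>k\<in>A. (\<delta> * cmod (c k))\<^sup>2)"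
      using \<delta> by (intro sum_mono power_mono) (auto simp: norm_mult mult.commute intro: mult_right_mono)
    also have "(\<Sum>k\<in>A. (\<delta> * cmod (c k))\<^sup>2) = (\<delta> * norm x)\<^sup>2"
      by (simp add: xc norm_sum_orthonormal[OF e A] power_mult_distrib sum_distrib_left)
    finally show ?thesis by (rule power2_le_imp_le) simp
  qed
  then have "complex_vector.span (range e) \<subseteq> ?B" by blast
  moreover have "closed ?B"
    by (intro closed_Collect_le continuous_intros D.continuous_on)
  ultimately have "closure (complex_vector.span (range e)) \<subseteq> ?B"
    by (rule closure_minimal)
  then show ?thesis using e by (auto simp: orthonormal_basis_def)
qed

lemma diagonal_surj:
  fixes e :: "nat \<Rightarrow> 'a::chilbert_space"
  assumes e: "orthonormal_basis e" and D: "bounded_clinear D"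
    and De: "\<And>n. D (e n) = \<alpha> n *\<^sub>C e n"
    and \<delta>: "0 < \<delta>" "\<And>n. \<delta> \<le> cmod (\<alpha> n)"
  shows "surj D"
proof -
  interpret D: bounded_linear D using D by (rule bounded_clinear_bounded_linear)
  have "e n \<in> range D" for n
  proof (rule range_eqI)
    have "\<alpha> n \<noteq> 0" using \<delta>(1) \<delta>(2)[of n] by auto
    then show "e n = D (inverse (\<alpha> n) *\<^sub>C e n)"
      by (simp add: bounded_clinear_scaleC[OF D] De scaleC_scaleC scaleC_one)
  qed
  moreover have "complex_vector.subspace (range D)"
  proof (rule complex_vector.subspaceI)
    show "0 \<in> range D" by (rule range_eqI[of _ _ 0]) (simp add: D.zero)
    show "x + y \<in> range D" if "x \<in> range D" "y \<in> range D" for x y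
      using that by (auto simp flip: D.add)
    show "c *\<^sub>C x \<in> range D" if "x \<in> range D" for c x
      using that by (auto simp flip: bounded_clinear_scaleC[OF D])
  qed
  ultimately have "complex_vector.span (range e) \<subseteq> range D"
    by (intro complex_vector.span_minimal) auto
  \<comment> \<open>A bounded linear map that is bounded below carries the complete space onto a
    complete, hence closed, set.\<close>
  moreover have "closed (range D)"
    using complete_isometric_image[OF \<delta>(1) subspace_UNIV D.bounded_linear_axioms _ complete_UNIV]
      diagonal_bounded_below[OF e D De less_imp_le[OF \<delta>(1)] \<delta>(2)]
    by (intro complete_imp_closed) blast
  ultimately have "closure (complex_vector.span (range e)) \<subseteq> range D"
    by (rule closure_minimal)
  then show ?thesis using e by (auto simp: orthonormal_basis_def)
qed

lemma diagonal_coefficients_bounded_below: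
  assumes e: "orthonormal_basis e" and De: "\<And>n. D (e n) = \<alpha> n *\<^sub>C e n"
    and nz: "\<And>n. \<alpha> n \<noteq> 0" and g: "(\<lambda>n. b n *\<^sub>C e n) sums g"
    and c: "0 < c" "\<And>x. c * norm x \<le> norm (D x + rank_one f g x)"
  obtains \<delta> where "0 < \<delta>" "\<And>n. \<delta> \<le> cmod (\<alpha> n)"
proof -
  have "(\<lambda>n. cmod (cinner (e n) g) * norm f) \<longlonglongrightarrow> 0"
    using cinner_orthonormal_tendsto_0[OF e g]
    by (intro tendsto_mult_left_zero tendsto_norm_zero)
  then have "\<forall>\<^sub>F n in sequentially. cmod (cinner (e n) g) * norm f < c / 2"
    using c(1) by (intro order_tendstoD) auto
  then obtain N where N: "\<And>n. n \<ge> N \<Longrightarrow> cmod (cinner (e n) g) * norm f < c / 2"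
    by (auto simp: eventually_sequentially)
  have large: "c / 2 \<le> cmod (\<alpha> n)" if "n \<ge> N" for n
  proof -
    \<comment> \<open>The lower bound is tested on the unit vector \<open>e n\<close>. The rank-one
      term costs less than \<open>c / 2\<close>, so \<open>\<alpha> n\<close> must supply the
      rest.\<close>
    have "c \<le> norm (\<alpha> n *\<^sub>C e n + cinner (e n) g *\<^sub>C f)"
      using c(2)[of "e n"] by (simp add: orthonormal_basis_norm[OF e] De rank_one_def)
    also have "\<dots> \<le> cmod (\<alpha> n) + cmod (cinner (e n) g) * norm f"
      by (rule norm_triangle_le) (simp add: norm_scaleC orthonormal_basis_norm[OF e])
    finally show ?thesis using N[OF that] by simp
  qed
  \<comment> \<open>The finitely many coefficients before \<open>N\<close> are nonzero, so this
    minimum is positive; inserting \<open>c / 2\<close> also keeps the set nonempty when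
    \<open>N\<close> is 0.\<close>
  define \<delta> where "\<delta> = Min (insert (c / 2) ((\<lambda>n. cmod (\<alpha> n)) ` {..<N}))"
  have "0 < \<delta>" using c(1) nz by (auto simp: \<delta>_def)
  moreover have "\<delta> \<le> cmod (\<alpha> n)" for n
  proof (cases "n < N")
    case True
    then show ?thesis by (auto simp: \<delta>_def intro: Min_le)
  next
    case False
    have "\<delta> \<le> c / 2" unfolding \<delta>_def by (rule Min_le) auto
    with False large[of n] show ?thesis by simp
  qed
  ultimately show thesis by (rule that)
qed

section \<open>The rank-one perturbation of a surjective operator\<close>

lemma surj_plus_rank_one:
  fixes D :: "'a::complex_inner \<Rightarrow> 'a"
  assumes D: "bounded_clinear D" and surj: "surj D"
    and inj: "inj (\<lambda>h. D h + rank_one f g h)"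
  shows "surj (\<lambda>h. D h + rank_one f g h)"
proof -
  interpret D: bounded_linear D using D by (rule bounded_clinear_bounded_linear)
  obtain u where u: "D u = f" using surj by (metis surjD)
  \<comment> \<open>The factorization of the operator as \<open>D\<close> after the identity plus
    \<open>rank_one u g\<close>.\<close>
  have T: "D h + rank_one f g h = D (h + cinner h g *\<^sub>C u)" for h
    by (simp add: rank_one_def D.add bounded_clinear_scaleC[OF D] u)
  have nz: "1 + cinner u g \<noteq> 0"
  proof
    \<comment> \<open>In that case the second factor annihilates \<open>u\<close>, so injectivity
      gives \<open>u = 0\<close>, and the assumption becomes 1 = 0.\<close>
    assume "1 + cinner u g = 0"
    then have "u + cinner u g *\<^sub>C u = 0"
      by (metis complex_vector.scale_zero_left scaleC_add_left scaleC_one)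
    then have "D u + rank_one f g u = D 0 + rank_one f g 0"
      unfolding T by simp
    then have "u = 0"
      by (rule injD[OF inj])
    with \<open>1 + cinner u g = 0\<close> show False by simp
  qed
  have "\<exists>h. y = D h + rank_one f g h" for y
  proof -
    obtain w where w: "y = D w" using surj by (metis surjD)
    \<comment> \<open>The vector \<open>w - t *\<^sub>C u\<close> is sent to \<open>w\<close> by the
      second factor exactly when its inner product with \<open>g\<close> equals \<open>t\<close>, at
      least if \<open>u\<close> is nonzero; solving for \<open>t\<close> gives this
      quotient.\<close>
    define t where "t = cinner w g / (1 + cinner u g)"
    have "cinner w g - t * cinner u g = t"
      using nz by (simp add: t_def field_simps)
    then have "y = D (w - t *\<^sub>C u) + rank_one f g (w - t *\<^sub>C u)"
      by (simp add: T cinner_diff_left cinner_scaleC_left w)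
    then show ?thesis ..
  qed
  then show ?thesis by (simp add: surj_def)
qed

theorem theorem1p3:
  fixes e :: "nat \<Rightarrow> 'a::chilbert_space"
    and D :: "'a \<Rightarrow> 'a"
    and \<alpha> a b :: "nat \<Rightarrow> complex"
    and f g :: 'a
  assumes "orthonormal_basis e"
    and "bounded_clinear D"
    and "\<And>n. D (e n) = \<alpha> n *\<^sub>C e n"
    and "\<And>n. \<alpha> n \<noteq> 0"
    and "(\<lambda>n. a n *\<^sub>C e n) sums f"
    and "(\<lambda>n. b n *\<^sub>C e n) sums g"
    and "\<And>n. a n \<noteq> 0"
    and "\<And>n. b n \<noteq> 0"
  shows "left_invertible_op (\<lambda>h. D h + rank_one f g h) \<longleftrightarrow>
         invertible_op (\<lambda>h. D h + rank_one f g h)"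
proof
  let ?T = "\<lambda>h. D h + rank_one f g h"
  assume "left_invertible_op ?T"
  then obtain S where S: "bounded_clinear S" and ST: "S \<circ> ?T = id"
    by (auto simp: left_invertible_op_def)
  have ST': "S (?T h) = h" for h
    using fun_cong[OF ST, of h] by simp
  obtain K where K: "0 < K" "\<And>x. norm (S x) \<le> norm x * K"
    using bounded_linear.pos_bounded[OF bounded_clinear_bounded_linear[OF S]] by blast
  \<comment> \<open>Since \<open>x = S (?T x)\<close>, the bound \<open>K\<close> for
    \<open>S\<close> yields a lower bound for \<open>?T\<close>.\<close>
  have "inverse K * norm x \<le> norm (?T x)" for x
    using K(2)[of "?T x"] K(1) by (simp add: ST' field_simps)
  then obtain \<delta> where "0 < \<delta>" "\<And>n. \<delta> \<le> cmod (\<alpha> n)"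
    using diagonal_coefficients_bounded_below[OF assms(1,3,4,6), of "inverse K" f] K(1)
    by (metis positive_imp_inverse_positive)
  then have "surj D"
    using diagonal_surj[OF assms(1-3)] by blast
  moreover have "inj ?T"
    by (rule inj_on_inverseI[of _ S]) (rule ST')
  ultimately have "surj ?T"
    by (intro surj_plus_rank_one assms(2))
  \<comment> \<open>A left inverse of a surjection is also a right inverse: for
    \<open>y = ?T h\<close> one has \<open>S y = h\<close>.\<close>
  have "?T (S y) = y" for y
  proof -
    obtain h where "y = ?T h" using surjD[OF \<open>surj ?T\<close>] by blast
    then show ?thesis by (simp only: ST')
  qed
  then have "?T \<circ> S = id" by (simp add: fun_eq_iff)
  with S ST show "invertible_op ?T"
    by (auto simp: invertible_op_def)
qed (auto simp: left_invertible_op_def invertible_op_def)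

end
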